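(* Let $n \geq 0$ and let $\mathbb{A}_1, \ldots, \mathbb{A}_n$ be finite categories that all have Euler characteristic. Then the coproduct (disjoint union) $\sum_i \mathbb{A}_i$ and the product $\prod_i \mathbb{A}_i$ have Euler characteristic, with $$\chi\Bigl(\sum_i \mathbb{A}_i\Bigr) = \sum_i \chi(\mathbb{A}_i), \qquad \chi\Bigl(\prod_i \mathbb{A}_i\Bigr) = \prod_i \chi(\mathbb{A}_i).$$
   Context: For a finite category $\mathbb{A}$, a weighting on $\mathbb{A}$ is a function $k^\bullet: \mathrm{ob}\,\mathbb{A} \to \mathbb{Q}$ such that $\sum_{b} |\mathbb{A}(a,b)|\, k^b = 1$ for all $a \in \mathbb{A}$. A coweighting $k_\bullet$ on $\mathbb{A}$ is a weighting on $\mathbb{A}^{\mathrm{op}}$. A finite category $\mathbb{A}$ has Euler characteristic if it admits both a weighting and a coweighting; its Euler characteristic is then $\chi(\mathbb{A}) = \sum_a k^a = \sum_a k_a \in \mathbb{Q}$ for any weighting $k^\bullet$ and coweighting $k_\bullet$ (the two sums agree and do not depend on the choices). *)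

theory Defs
  imports Complex_Main "HOL-Library.FuncSet"
begin

text \<open>Categories with explicit carriers of objects and arrows; \<open>Comp C g f\<close> is \<open>g \<circ> f\<close>, and is only
  meaningful when \<open>Cod C f = Dom C g\<close>.\<close>

record ('o, 'm) cat =
  Obj :: "'o set"
  Arr :: "'m set"
  Dom :: "'m \<Rightarrow> 'o"
  Cod :: "'m \<Rightarrow> 'o"
  Id :: "'o \<Rightarrow> 'm"
  Comp :: "'m \<Rightarrow> 'm \<Rightarrow> 'm"

locale category =
  fixes C :: "('o, 'm) cat"
  assumes Dom_Obj: "f \<in> Arr C \<Longrightarrow> Dom C f \<in> Obj C"
    and Cod_Obj: "f \<in> Arr C \<Longrightarrow> Cod C f \<in> Obj C"
    and Id_Arr: "a \<in> Obj C \<Longrightarrow> Id C a \<in> Arr C"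
    and Dom_Id: "a \<in> Obj C \<Longrightarrow> Dom C (Id C a) = a"
    and Cod_Id: "a \<in> Obj C \<Longrightarrow> Cod C (Id C a) = a"
    and Comp_Arr: "\<lbrakk>f \<in> Arr C; g \<in> Arr C; Cod C f = Dom C g\<rbrakk> \<Longrightarrow> Comp C g f \<in> Arr C"
    and Dom_Comp: "\<lbrakk>f \<in> Arr C; g \<in> Arr C; Cod C f = Dom C g\<rbrakk> \<Longrightarrow> Dom C (Comp C g f) = Dom C f"
    and Cod_Comp: "\<lbrakk>f \<in> Arr C; g \<in> Arr C; Cod C f = Dom C g\<rbrakk> \<Longrightarrow> Cod C (Comp C g f) = Cod C g"
    and Comp_Id: "f \<in> Arr C \<Longrightarrow> Comp C f (Id C (Dom C f)) = f"
    and Id_Comp: "f \<in> Arr C \<Longrightarrow> Comp C (Id C (Cod C f)) f = f"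
    and Comp_assoc: "\<lbrakk>f \<in> Arr C; g \<in> Arr C; h \<in> Arr C; Cod C f = Dom C g; Cod C g = Dom C h\<rbrakk>
      \<Longrightarrow> Comp C h (Comp C g f) = Comp C (Comp C h g) f"

locale finite_category = category +
  assumes finite_Obj: "finite (Obj C)"
    and finite_Arr: "finite (Arr C)"

definition Hom :: "('o, 'm) cat \<Rightarrow> 'o \<Rightarrow> 'o \<Rightarrow> 'm set" where
  "Hom C a b = {f \<in> Arr C. Dom C f = a \<and> Cod C f = b}"

definition op_cat :: "('o, 'm) cat \<Rightarrow> ('o, 'm) cat" where
  "op_cat C = \<lparr>Obj = Obj C, Arr = Arr C, Dom = Cod C, Cod = Dom C, Id = Id C,
    Comp = (\<lambda>g f. Comp C f g)\<rparr>"

definition weighting :: "('o, 'm) cat \<Rightarrow> ('o \<Rightarrow> rat) \<Rightarrow> bool" where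
  "weighting C k \<longleftrightarrow> (\<forall>a\<in>Obj C. (\<Sum>b\<in>Obj C. of_nat (card (Hom C a b)) * k b) = 1)"

definition coweighting :: "('o, 'm) cat \<Rightarrow> ('o \<Rightarrow> rat) \<Rightarrow> bool" where
  "coweighting C k \<longleftrightarrow> weighting (op_cat C) k"

definition has_euler_char :: "('o, 'm) cat \<Rightarrow> bool" where
  "has_euler_char C \<longleftrightarrow> finite_category C \<and> (\<exists>k. weighting C k) \<and> (\<exists>k. coweighting C k)"

text \<open>Meaningful only under \<^const>\<open>has_euler_char\<close>; \<open>euler_char_eq\<close> below shows that the value
  described then exists and is unique.\<close>

definition euler_char :: "('o, 'm) cat \<Rightarrow> rat" where
  "euler_char C = (THE x. (\<forall>k. weighting C k \<longrightarrow> (\<Sum>a\<in>Obj C. k a) = x) \<and>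
    (\<forall>k. coweighting C k \<longrightarrow> (\<Sum>a\<in>Obj C. k a) = x))"

definition coproduct_cat :: "'i set \<Rightarrow> ('i \<Rightarrow> ('o, 'm) cat) \<Rightarrow> ('i \<times> 'o, 'i \<times> 'm) cat" where
  "coproduct_cat I A = \<lparr>Obj = (SIGMA i:I. Obj (A i)), Arr = (SIGMA i:I. Arr (A i)),
    Dom = (\<lambda>(i, f). (i, Dom (A i) f)), Cod = (\<lambda>(i, f). (i, Cod (A i) f)),
    Id = (\<lambda>(i, a). (i, Id (A i) a)),
    Comp = (\<lambda>(i, g) (j, f). (i, Comp (A i) g f))\<rparr>"

text \<open>Objects and arrows are families that are \<^const>\<open>undefined\<close> outside \<open>I\<close>, so each family
  over \<open>I\<close> is represented exactly once.\<close>

definition product_cat :: "'i set \<Rightarrow> ('i \<Rightarrow> ('o, 'm) cat) \<Rightarrow> ('i \<Rightarrow> 'o, 'i \<Rightarrow> 'm) cat" where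
  "product_cat I A = \<lparr>Obj = (\<Pi>\<^sub>E i\<in>I. Obj (A i)), Arr = (\<Pi>\<^sub>E i\<in>I. Arr (A i)),
    Dom = (\<lambda>f. \<lambda>i\<in>I. Dom (A i) (f i)), Cod = (\<lambda>f. \<lambda>i\<in>I. Cod (A i) (f i)),
    Id = (\<lambda>a. \<lambda>i\<in>I. Id (A i) (a i)),
    Comp = (\<lambda>g f. \<lambda>i\<in>I. Comp (A i) (g i) (f i))\<rparr>"

lemma weighting_coweighting_sum_eq:
  assumes "weighting C k" and "coweighting C l"
  shows "(\<Sum>a\<in>Obj C. k a) = (\<Sum>a\<in>Obj C. l a)"
proof -
  let ?z = "\<lambda>a b. of_nat (card (Hom C a b)) :: rat"
  have Hop: "Hom (op_cat C) b a = Hom C a b" for a b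
    by (auto simp: Hom_def op_cat_def)
  have Oop: "Obj (op_cat C) = Obj C"
    by (simp add: op_cat_def)
  have w: "(\<Sum>b\<in>Obj C. ?z a b * k b) = 1" if "a \<in> Obj C" for a
    using assms(1) that by (simp add: weighting_def)
  have cw: "(\<Sum>a\<in>Obj C. ?z a b * l a) = 1" if "b \<in> Obj C" for b
    using assms(2) that by (simp add: coweighting_def weighting_def Hop Oop)
  have "(\<Sum>b\<in>Obj C. k b) = (\<Sum>b\<in>Obj C. (\<Sum>a\<in>Obj C. ?z a b * l a) * k b)"
    by (intro sum.cong refl) (simp add: cw)
  also have "\<dots> = (\<Sum>b\<in>Obj C. \<Sum>a\<in>Obj C. l a * (?z a b * k b))"
    by (simp add: sum_distrib_right sum_distrib_left mult_ac)
  also have "\<dots> = (\<Sum>a\<in>Obj C. \<Sum>b\<in>Obj C. l a * (?z a b * k b))"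
    by (rule sum.swap)
  also have "\<dots> = (\<Sum>a\<in>Obj C. l a * (\<Sum>b\<in>Obj C. ?z a b * k b))"
    by (simp add: sum_distrib_left)
  also have "\<dots> = (\<Sum>a\<in>Obj C. l a)"
    by (intro sum.cong refl) (simp add: w)
  finally show ?thesis .
qed

lemma euler_char_eq:
  assumes "has_euler_char C"
  shows "weighting C k \<Longrightarrow> euler_char C = (\<Sum>a\<in>Obj C. k a)"
    and "coweighting C l \<Longrightarrow> euler_char C = (\<Sum>a\<in>Obj C. l a)"
proof -
  obtain k0 l0 where kl: "weighting C k0" "coweighting C l0"
    using assms by (auto simp: has_euler_char_def)
  have eq: "euler_char C = (\<Sum>a\<in>Obj C. k0 a)"
    unfolding euler_char_def
  proof (rule the_equality)
    show "(\<forall>k. weighting C k \<longrightarrow> (\<Sum>a\<in>Obj C. k a) = (\<Sum>a\<in>Obj C. k0 a)) \<and>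
        (\<forall>k. coweighting C k \<longrightarrow> (\<Sum>a\<in>Obj C. k a) = (\<Sum>a\<in>Obj C. k0 a))"
      using kl weighting_coweighting_sum_eq by metis
  qed (use kl in blast)
  show "weighting C k \<Longrightarrow> euler_char C = (\<Sum>a\<in>Obj C. k a)"
    using eq kl weighting_coweighting_sum_eq by metis
  show "coweighting C l \<Longrightarrow> euler_char C = (\<Sum>a\<in>Obj C. l a)"
    using eq kl weighting_coweighting_sum_eq by metis
qed

end

theory Submission
  imports Defs
begin

text \<open>
  A weighting solves the linear system whose matrix is \<open>Z a b = |C(a, b)|\<close>. For a coproduct this
  matrix is block diagonal with the matrices of the summands as blocks, so solutions for the summands
  can be placed side by side, and their entries add up to the sum of the Euler characteristics. For
  a product an arrow is a family of arrows, so the matrix is the tensor product of the matrices of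
  the factors, and the tensor product \<open>k a = (\<Prod>i\<in>I. k\<^sub>i (a i))\<close> of solutions is again a solution:
  by distributivity, a sum over families of a product over \<open>I\<close> is the product over \<open>I\<close> of the sums,
  here a product of ones. The same distributivity turns the sum of the entries of \<open>k\<close> into the
  product of the Euler characteristics.

  The statements about coweightings follow by duality: a weighting depends only on the objects and
  the graph of arrows of a category, and on these both constructions commute with taking opposites.
\<close>

lemma op_cat_simps [simp]:
  "Obj (op_cat C) = Obj C" "Arr (op_cat C) = Arr C"
  "Dom (op_cat C) = Cod C" "Cod (op_cat C) = Dom C"
  by (simp_all add: op_cat_def)

lemma coproduct_cat_simps [simp]:
  "Obj (coproduct_cat I A) = (SIGMA i:I. Obj (A i))"
  "Arr (coproduct_cat I A) = (SIGMA i:I. Arr (A i))"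
  "Dom (coproduct_cat I A) = (\<lambda>(i, f). (i, Dom (A i) f))"
  "Cod (coproduct_cat I A) = (\<lambda>(i, f). (i, Cod (A i) f))"
  "Id (coproduct_cat I A) = (\<lambda>(i, a). (i, Id (A i) a))"
  "Comp (coproduct_cat I A) = (\<lambda>(i, g) (j, f). (i, Comp (A i) g f))"
  by (simp_all add: coproduct_cat_def)

lemma product_cat_simps [simp]:
  "Obj (product_cat I A) = (\<Pi>\<^sub>E i\<in>I. Obj (A i))"
  "Arr (product_cat I A) = (\<Pi>\<^sub>E i\<in>I. Arr (A i))"
  "Dom (product_cat I A) = (\<lambda>f. \<lambda>i\<in>I. Dom (A i) (f i))"
  "Cod (product_cat I A) = (\<lambda>f. \<lambda>i\<in>I. Cod (A i) (f i))"
  "Id (product_cat I A) = (\<lambda>a. \<lambda>i\<in>I. Id (A i) (a i))"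
  "Comp (product_cat I A) = (\<lambda>g f. \<lambda>i\<in>I. Comp (A i) (g i) (f i))"
  by (simp_all add: product_cat_def)

text \<open>
  Passing through this congruence rather than through equality of categories matters for coproducts:
  the opposite of a coproduct and the coproduct of the opposites can differ in the value of \<open>Comp\<close>
  at pairs of arrows from different summands, which are never composable.
\<close>

lemma weighting_cong_graph:
  assumes "Obj C = Obj D" "Arr C = Arr D" "Dom C = Dom D" "Cod C = Cod D"
  shows "weighting C k \<longleftrightarrow> weighting D k"
  using assms by (simp add: weighting_def Hom_def)

lemma weighting_op_coproduct_cat:
  "weighting (op_cat (coproduct_cat I A)) = weighting (coproduct_cat I (\<lambda>i. op_cat (A i)))"
  by (intro ext weighting_cong_graph) simp_all

lemma weighting_op_product_cat:
  "weighting (op_cat (product_cat I A)) = weighting (product_cat I (\<lambda>i. op_cat (A i)))"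
  by (intro ext weighting_cong_graph) simp_all

lemma has_euler_charE:
  assumes "has_euler_char C"
  obtains k l where "finite_category C" "weighting C k" "coweighting C l"
    "euler_char C = (\<Sum>a\<in>Obj C. k a)"
  using assms euler_char_eq(1)[OF assms] by (auto simp: has_euler_char_def)

lemma has_euler_charI:
  assumes "finite_category C" "weighting C k" "coweighting C l"
  shows "has_euler_char C" and "euler_char C = (\<Sum>a\<in>Obj C. k a)"
proof -
  show "has_euler_char C"
    using assms by (auto simp: has_euler_char_def)
  then show "euler_char C = (\<Sum>a\<in>Obj C. k a)"
    using assms(2) by (rule euler_char_eq(1))
qed

lemma category_coproduct_cat:
  assumes "\<And>i. i \<in> I \<Longrightarrow> category (A i)"
  shows "category (coproduct_cat I A)"
  by unfold_locales (auto simp: assms category.Dom_Obj category.Cod_Obj category.Id_Arr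
      category.Dom_Id category.Cod_Id category.Comp_Arr category.Dom_Comp category.Cod_Comp
      category.Comp_Id category.Id_Comp category.Comp_assoc)

lemma finite_category_coproduct_cat:
  assumes "finite I" "\<And>i. i \<in> I \<Longrightarrow> finite_category (A i)"
  shows "finite_category (coproduct_cat I A)"
proof -
  have "category (coproduct_cat I A)"
    using assms(2) by (intro category_coproduct_cat) (simp add: finite_category_def)
  moreover have "finite (Obj (A i))" "finite (Arr (A i))" if "i \<in> I" for i
    using assms(2)[OF that] finite_category.finite_Obj finite_category.finite_Arr by auto
  ultimately show ?thesis
    using assms(1) by (auto simp: finite_category_def finite_category_axioms_def)
qed

lemma card_Hom_coproduct_cat:
  assumes "i \<in> I"
  shows "card (Hom (coproduct_cat I A) (i, a) (j, b)) = (if i = j then card (Hom (A i) a b) else 0)"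
proof -
  have "Hom (coproduct_cat I A) (i, a) (j, b) = (if i = j then Pair i ` Hom (A i) a b else {})"
    using assms by (auto simp: Hom_def)
  then show ?thesis
    by (simp add: card_image inj_on_def)
qed

text \<open>The matrix of hom-set sizes is block diagonal, so each row of the system for the coproduct is a
  row of the system for a single summand.\<close>

lemma weighting_coproduct_cat:
  assumes fin: "finite I" "\<And>i. i \<in> I \<Longrightarrow> finite (Obj (A i))"
    and w: "\<And>i. i \<in> I \<Longrightarrow> weighting (A i) (k i)"
  shows "weighting (coproduct_cat I A) (\<lambda>(i, a). k i a)"
  unfolding weighting_def
proof (clarsimp)
  fix i a assume i: "i \<in> I" and a: "a \<in> Obj (A i)"
  let ?h = "\<lambda>j b. of_nat (card (Hom (coproduct_cat I A) (i, a) (j, b))) * k j b"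
  have "(\<Sum>x\<in>(SIGMA j:I. Obj (A j)). of_nat (card (Hom (coproduct_cat I A) (i, a) x)) *
      (case x of (j, b) \<Rightarrow> k j b)) = (\<Sum>j\<in>I. \<Sum>b\<in>Obj (A j). ?h j b)"
    using fin by (subst sum.Sigma) (auto intro!: sum.cong)
  also have "\<dots> = (\<Sum>j\<in>I. if i = j then \<Sum>b\<in>Obj (A i). of_nat (card (Hom (A i) a b)) * k i b else 0)"
    using i by (intro sum.cong) (auto simp: card_Hom_coproduct_cat)
  also have "\<dots> = (\<Sum>b\<in>Obj (A i). of_nat (card (Hom (A i) a b)) * k i b)"
    using fin(1) i by simp
  also have "\<dots> = 1"
    using w[OF i] a by (simp add: weighting_def)
  finally show "(\<Sum>x\<in>(SIGMA j:I. Obj (A j)). of_nat (card (Hom (coproduct_cat I A) (i, a) x)) *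
      (case x of (j, b) \<Rightarrow> k j b)) = 1" .
qed

theorem euler_char_coproduct_cat:
  assumes "finite I" "\<And>i. i \<in> I \<Longrightarrow> has_euler_char (A i)"
  shows "has_euler_char (coproduct_cat I A)"
    and "euler_char (coproduct_cat I A) = (\<Sum>i\<in>I. euler_char (A i))"
proof -
  have "\<forall>i\<in>I. \<exists>k l. finite_category (A i) \<and> weighting (A i) k \<and> coweighting (A i) l \<and>
      euler_char (A i) = (\<Sum>a\<in>Obj (A i). k a)"
    using assms(2) has_euler_charE by metis
  then obtain k l where kl: "\<And>i. i \<in> I \<Longrightarrow> finite_category (A i)"
    "\<And>i. i \<in> I \<Longrightarrow> weighting (A i) (k i)" "\<And>i. i \<in> I \<Longrightarrow> coweighting (A i) (l i)"
    and chi: "\<And>i. i \<in> I \<Longrightarrow> euler_char (A i) = (\<Sum>a\<in>Obj (A i). k i a)"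
    by metis
  have fin: "\<And>i. i \<in> I \<Longrightarrow> finite (Obj (A i))"
    using kl(1) finite_category.finite_Obj by blast
  have "weighting (coproduct_cat I A) (\<lambda>(i, a). k i a)"
    using assms(1) fin kl(2) by (rule weighting_coproduct_cat)
  moreover have "coweighting (coproduct_cat I A) (\<lambda>(i, a). l i a)"
    unfolding coweighting_def weighting_op_coproduct_cat
    using assms(1) fin kl(3) by (intro weighting_coproduct_cat) (auto simp: coweighting_def)
  ultimately show "has_euler_char (coproduct_cat I A)"
    and "euler_char (coproduct_cat I A) = (\<Sum>i\<in>I. euler_char (A i))"
    using has_euler_charI[OF finite_category_coproduct_cat[OF assms(1) kl(1)]] assms(1) fin
    by (simp_all add: sum.Sigma chi)
qed

lemma category_product_cat:
  assumes "\<And>i. i \<in> I \<Longrightarrow> category (A i)"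
  shows "category (product_cat I A)"
proof
  note laws = category.Dom_Obj category.Cod_Obj category.Id_Arr category.Dom_Id category.Cod_Id
    category.Comp_Arr category.Dom_Comp category.Cod_Comp category.Comp_Id category.Id_Comp
    category.Comp_assoc
  have composable: "Cod (A i) (f i) = Dom (A i) (g i)"
    if "Cod (product_cat I A) f = Dom (product_cat I A) g" "i \<in> I" for f g i
    using fun_cong[OF that(1), of i] that(2) by simp
  fix f g h :: "'a \<Rightarrow> 'c" and a :: "'a \<Rightarrow> 'b"
  show "a \<in> Obj (product_cat I A) \<Longrightarrow> Id (product_cat I A) a \<in> Arr (product_cat I A)"
    "a \<in> Obj (product_cat I A) \<Longrightarrow> Dom (product_cat I A) (Id (product_cat I A) a) = a"
    "a \<in> Obj (product_cat I A) \<Longrightarrow> Cod (product_cat I A) (Id (product_cat I A) a) = a"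
    by (auto simp: fun_eq_iff PiE_iff extensional_def assms laws)
  assume f: "f \<in> Arr (product_cat I A)"
  show "Dom (product_cat I A) f \<in> Obj (product_cat I A)"
    "Cod (product_cat I A) f \<in> Obj (product_cat I A)"
    "Comp (product_cat I A) f (Id (product_cat I A) (Dom (product_cat I A) f)) = f"
    "Comp (product_cat I A) (Id (product_cat I A) (Cod (product_cat I A) f)) f = f"
    using f by (auto simp: fun_eq_iff PiE_iff extensional_def assms laws)
  assume g: "g \<in> Arr (product_cat I A)" and fg: "Cod (product_cat I A) f = Dom (product_cat I A) g"
  show "Comp (product_cat I A) g f \<in> Arr (product_cat I A)"
    "Dom (product_cat I A) (Comp (product_cat I A) g f) = Dom (product_cat I A) f"
    "Cod (product_cat I A) (Comp (product_cat I A) g f) = Cod (product_cat I A) g"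
    using f g composable[OF fg] by (auto simp: fun_eq_iff PiE_iff assms laws)
  assume h: "h \<in> Arr (product_cat I A)" and gh: "Cod (product_cat I A) g = Dom (product_cat I A) h"
  show "Comp (product_cat I A) h (Comp (product_cat I A) g f) =
      Comp (product_cat I A) (Comp (product_cat I A) h g) f"
    using f g h composable[OF fg] composable[OF gh] by (auto simp: fun_eq_iff PiE_iff assms laws)
qed

lemma finite_category_product_cat:
  assumes "finite I" "\<And>i. i \<in> I \<Longrightarrow> finite_category (A i)"
  shows "finite_category (product_cat I A)"
proof -
  have "category (product_cat I A)"
    using assms(2) by (intro category_product_cat) (simp add: finite_category_def)
  moreover have "finite (Obj (A i))" "finite (Arr (A i))" if "i \<in> I" for i
    using assms(2)[OF that] finite_category.finite_Obj finite_category.finite_Arr by auto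
  ultimately show ?thesis
    using assms(1) by (auto simp: finite_category_def finite_category_axioms_def intro!: finite_PiE)
qed

lemma Hom_product_cat:
  assumes "a \<in> (\<Pi>\<^sub>E i\<in>I. Obj (A i))" "b \<in> (\<Pi>\<^sub>E i\<in>I. Obj (A i))"
  shows "Hom (product_cat I A) a b = (\<Pi>\<^sub>E i\<in>I. Hom (A i) (a i) (b i))"
proof -
  have restrict_eq: "restrict u I = c \<longleftrightarrow> (\<forall>i\<in>I. u i = c i)" if "c \<in> (\<Pi>\<^sub>E i\<in>I. Obj (A i))" for u c
    using that by (metis PiE_restrict restrict_apply' restrict_ext)
  show ?thesis
    by (auto simp: Hom_def restrict_eq[OF assms(1)] restrict_eq[OF assms(2)] PiE_iff extensional_def)
qed

text \<open>The matrix of hom-set sizes is the tensor product of the matrices of the factors, and the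
  tensor product of solutions is a solution because a sum over families factorises.\<close>

lemma weighting_product_cat:
  assumes fin: "finite I" "\<And>i. i \<in> I \<Longrightarrow> finite (Obj (A i))"
    and w: "\<And>i. i \<in> I \<Longrightarrow> weighting (A i) (k i)"
  shows "weighting (product_cat I A) (\<lambda>a. \<Prod>i\<in>I. k i (a i))"
  unfolding weighting_def
proof
  fix a assume "a \<in> Obj (product_cat I A)"
  then have a: "a \<in> (\<Pi>\<^sub>E i\<in>I. Obj (A i))"
    by simp
  have "(\<Sum>b\<in>Obj (product_cat I A). of_nat (card (Hom (product_cat I A) a b)) * (\<Prod>i\<in>I. k i (b i)))
      = (\<Sum>b\<in>(\<Pi>\<^sub>E i\<in>I. Obj (A i)). \<Prod>i\<in>I. of_nat (card (Hom (A i) (a i) (b i))) * k i (b i))"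
    using a fin(1) by (intro sum.cong) (simp_all add: Hom_product_cat card_PiE prod.distrib)
  also have "\<dots> = (\<Prod>i\<in>I. \<Sum>b\<in>Obj (A i). of_nat (card (Hom (A i) (a i) b)) * k i b)"
    using fin by (simp add: prod_sum_PiE)
  also have "\<dots> = 1"
    using w a by (intro prod.neutral) (auto simp: weighting_def PiE_mem)
  finally show "(\<Sum>b\<in>Obj (product_cat I A). of_nat (card (Hom (product_cat I A) a b)) *
      (\<Prod>i\<in>I. k i (b i))) = 1" .
qed

theorem euler_char_product_cat:
  assumes "finite I" "\<And>i. i \<in> I \<Longrightarrow> has_euler_char (A i)"
  shows "has_euler_char (product_cat I A)"
    and "euler_char (product_cat I A) = (\<Prod>i\<in>I. euler_char (A i))"
proof -
  have "\<forall>i\<in>I. \<exists>k l. finite_category (A i) \<and> weighting (A i) k \<and> coweighting (A i) l \<and>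
      euler_char (A i) = (\<Sum>a\<in>Obj (A i). k a)"
    using assms(2) has_euler_charE by metis
  then obtain k l where kl: "\<And>i. i \<in> I \<Longrightarrow> finite_category (A i)"
    "\<And>i. i \<in> I \<Longrightarrow> weighting (A i) (k i)" "\<And>i. i \<in> I \<Longrightarrow> coweighting (A i) (l i)"
    and chi: "\<And>i. i \<in> I \<Longrightarrow> euler_char (A i) = (\<Sum>a\<in>Obj (A i). k i a)"
    by metis
  have fin: "\<And>i. i \<in> I \<Longrightarrow> finite (Obj (A i))"
    using kl(1) finite_category.finite_Obj by blast
  have "weighting (product_cat I A) (\<lambda>a. \<Prod>i\<in>I. k i (a i))"
    using assms(1) fin kl(2) by (rule weighting_product_cat)
  moreover have "coweighting (product_cat I A) (\<lambda>a. \<Prod>i\<in>I. l i (a i))"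
    unfolding coweighting_def weighting_op_product_cat
    using assms(1) fin kl(3) by (intro weighting_product_cat) (auto simp: coweighting_def)
  ultimately show "has_euler_char (product_cat I A)"
    and "euler_char (product_cat I A) = (\<Prod>i\<in>I. euler_char (A i))"
    using has_euler_charI[OF finite_category_product_cat[OF assms(1) kl(1)]] assms(1) fin
    by (simp_all add: prod_sum_PiE chi)
qed

theorem proposition2p6:
  fixes n :: nat and A :: "nat \<Rightarrow> ('o, 'm) cat"
  assumes "\<And>i. i \<in> {1..n} \<Longrightarrow> has_euler_char (A i)"
  shows "has_euler_char (coproduct_cat {1..n} A) \<and>
    has_euler_char (product_cat {1..n} A) \<and>
    euler_char (coproduct_cat {1..n} A) = (\<Sum>i = 1..n. euler_char (A i)) \<and>
    euler_char (product_cat {1..n} A) = (\<Prod>i = 1..n. euler_char (A i))"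
  using euler_char_coproduct_cat[of "{1..n}" A] euler_char_product_cat[of "{1..n}" A] assms
  by blast

end
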